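(* Let $\|\cdot\|$ be a norm on $\mathbb{R}^d$ and let $f^{\{1\}},\dots,f^{\{N\}}:\mathbb{R}^d\to\mathbb{R}^d$ be such that there exist $\rho^{\{1\}},\dots,\rho^{\{N\}}>0$ with $$\big\|y+\rho^{\{m\}}f^{\{m\}}(y)\big\|\le\|y\|\qquad\text{for all }y\in\mathbb{R}^d,\ m=1,\dots,N.$$ Consider a GARK scheme defined by the matrix $\widehat{\mathbf{A}}$, applied to $y'=\sum_{m=1}^N f^{\{m\}}(y)$, and let $r=(r^{\{1\}},\dots,r^{\{N\}})$ be a point in the interior of its region of absolute monotonicity, $r\in\mathcal{R}(\widehat{\mathbf{A}})$, with $r^{\{q\}}>0$ for all $q$. Then for any step size $h>0$ obeying $$h\le\min_{q=1,\dots,N}\big\{r^{\{q\}}\rho^{\{q\}}\big\}$$ the stage values and the solution of the GARK scheme are monotonic: $$\big\|Y_i^{\{q\}}\big\|\le\|y_n\|,\quad q=1,\dots,N,\ i=1,\dots,s^{\{q\}},\qquad\text{and}\qquad \|y_{n+1}\|\le\|y_n\|.$$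
   Context: GARK method: with real coefficients $\mathbf{A}^{\{q,m\}}=(a_{i,j}^{\{q,m\}})\in\mathbb{R}^{s^{\{q\}}\times s^{\{m\}}}$, $\mathbf{b}^{\{q\}}=(b_i^{\{q\}})\in\mathbb{R}^{s^{\{q\}}}$, one step of size $h$ is $$Y_i^{\{q\}} = y_n + h\sum_{m=1}^N\sum_{j=1}^{s^{\{m\}}} a_{i,j}^{\{q,m\}} f^{\{m\}}\big(Y_j^{\{m\}}\big),\quad i=1,\dots,s^{\{q\}},\ q=1,\dots,N,$$ $$y_{n+1}=y_n+h\sum_{q=1}^N\sum_{i=1}^{s^{\{q\}}} b_i^{\{q\}} f^{\{q\}}\big(Y_i^{\{q\}}\big),$$ where $Y_i^{\{q\}},y_{n+1}$ are values satisfying these equations. Let $s=\sum_q s^{\{q\}}$, $\hat s=s+1$, let $\mathbf{A}=[\mathbf{A}^{\{q,m\}}]_{1\le q,m\le N}\in\mathbb{R}^{s\times s}$ be the block matrix, $\mathbf{b}\in\mathbb{R}^s$ the stacked vector of $\mathbf{b}^{\{1\}},\dots,\mathbf{b}^{\{N\}}$, and $$\widehat{\mathbf{A}}=\begin{bmatrix}\mathbf{A}&\mathbf{0}\\ \mathbf{b}^T&0\end{bmatrix}\in\mathbb{R}^{\hat s\times\hat s}.$$ For $r=(r^{\{1\}},\dots,r^{\{N\}})$ with non-negative entries let $\widehat{\mathbf{R}}=\mathrm{diag}\{r^{\{1\}}\mathbf{I}_{s^{\{1\}}},\dots,r^{\{N\}}\mathbf{I}_{s^{\{N\}}},1\}$,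 where $\mathbf{I}_k$ is the $k\times k$ identity. All inequalities between vectors or matrices are entrywise. Absolute monotonicity: a GARK scheme with $\widehat{\mathbf{A}}\ge0$ is absolutely monotonic (a.m.) at $r$ if $\mathbf{I}_{\hat s}+\widehat{\mathbf{A}}\widehat{\mathbf{R}}$ is invertible and $$\alpha(r)=(\mathbf{I}_{\hat s}+\widehat{\mathbf{A}}\widehat{\mathbf{R}})^{-1}\mathbf{1}\ge0,\qquad \beta(r)=(\mathbf{I}_{\hat s}+\widehat{\mathbf{A}}\widehat{\mathbf{R}})^{-1}\widehat{\mathbf{A}}\widehat{\mathbf{R}}=\mathbf{I}_{\hat s}-(\mathbf{I}_{\hat s}+\widehat{\mathbf{A}}\widehat{\mathbf{R}})^{-1}\ge0,$$ where $\mathbf{1}\in\mathbb{R}^{\hat s}$ is the vector of ones. The region of absolute monotonicity $\mathcal{R}(\widehat{\mathbf{A}})$ is the set of $r\in\mathbb{R}^N$ with non-negative entries such that $\widehat{\mathbf{A}}\ge0$ is a.m. at every point of $[0,r^{\{1\}}]\times\dots\times[0,r^{\{N\}}]$. *)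

theory Defs
  imports
    "HOL-Analysis.Analysis"
    "Jordan_Normal_Form.Gauss_Jordan_Elimination"
begin

text \<open>
  Component methods and stages are counted from 0: partitions are \<open>q < N\<close>, the stages of
  partition \<open>q\<close> are \<open>i < s q\<close>. The coefficients are \<open>A q m \<in> carrier_mat (s q) (s m)\<close> and
  \<open>b q \<in> carrier_vec (s q)\<close>. Points of \<open>\<real>\<^sup>N\<close> are the elements of the topological space
  \<^const>\<open>Euclidean_space\<close> \<open>N\<close>, that is, functions on \<open>nat\<close> vanishing at all \<open>q \<ge> N\<close>.
\<close>

(* The type class norm fixes one norm per type; this predicate expresses an arbitrary one. *)
definition is_norm :: "('v::real_vector \<Rightarrow> real) \<Rightarrow> bool" where
  "is_norm \<nu> \<longleftrightarrow>
     (\<forall>x. 0 \<le> \<nu> x) \<and>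
     (\<forall>x. \<nu> x = 0 \<longleftrightarrow> x = 0) \<and>
     (\<forall>c x. \<nu> (c *\<^sub>R x) = \<bar>c\<bar> * \<nu> x) \<and>
     (\<forall>x y. \<nu> (x + y) \<le> \<nu> x + \<nu> y)"

definition gark_coeffs ::
  "nat \<Rightarrow> (nat \<Rightarrow> nat) \<Rightarrow> (nat \<Rightarrow> nat \<Rightarrow> real mat) \<Rightarrow> (nat \<Rightarrow> real vec) \<Rightarrow> bool" where
  "gark_coeffs N s A b \<longleftrightarrow>
     (\<forall>q<N. \<forall>m<N. A q m \<in> carrier_mat (s q) (s m)) \<and>
     (\<forall>q<N. b q \<in> carrier_vec (s q))"

(* A relation, since the implicit stage equations need not be uniquely solvable. *)
definition gark_step ::
  "nat \<Rightarrow> (nat \<Rightarrow> nat) \<Rightarrow> (nat \<Rightarrow> nat \<Rightarrow> real mat) \<Rightarrow> (nat \<Rightarrow> real vec)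
     \<Rightarrow> (nat \<Rightarrow> 'v \<Rightarrow> 'v) \<Rightarrow> real \<Rightarrow> 'v \<Rightarrow> (nat \<Rightarrow> nat \<Rightarrow> 'v) \<Rightarrow> 'v::real_vector \<Rightarrow> bool" where
  "gark_step N s A b f h y\<^sub>n Y y\<^sub>n\<^sub>1 \<longleftrightarrow>
     (\<forall>q<N. \<forall>i<s q.
        Y q i = y\<^sub>n + h *\<^sub>R (\<Sum>m<N. \<Sum>j<s m. index_mat (A q m) (i, j) *\<^sub>R f m (Y m j))) \<and>
     y\<^sub>n\<^sub>1 = y\<^sub>n + h *\<^sub>R (\<Sum>q<N. \<Sum>i<s q. vec_index (b q) i *\<^sub>R f q (Y q i))"

definition num_stages :: "nat \<Rightarrow> (nat \<Rightarrow> nat) \<Rightarrow> nat" where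
  "num_stages N s = (\<Sum>q<N. s q)"

(* The k-th row of the stacked system is stage i of partition q, where (q, i) = stages N s ! k. *)
definition stages :: "nat \<Rightarrow> (nat \<Rightarrow> nat) \<Rightarrow> (nat \<times> nat) list" where
  "stages N s = [(q, i). q \<leftarrow> [0..<N], i \<leftarrow> [0..<s q]]"

definition gark_A :: "nat \<Rightarrow> (nat \<Rightarrow> nat) \<Rightarrow> (nat \<Rightarrow> nat \<Rightarrow> real mat) \<Rightarrow> real mat" where
  "gark_A N s A = Matrix.mat (num_stages N s) (num_stages N s)
     (\<lambda>(k, l). case (stages N s ! k, stages N s ! l) of
        ((q, i), (m, j)) \<Rightarrow> index_mat (A q m) (i, j))"

definition gark_b :: "nat \<Rightarrow> (nat \<Rightarrow> nat) \<Rightarrow> (nat \<Rightarrow> real vec) \<Rightarrow> real vec" where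
  "gark_b N s b = Matrix.vec (num_stages N s)
     (\<lambda>k. case stages N s ! k of (q, i) \<Rightarrow> vec_index (b q) i)"

definition gark_Ahat ::
  "nat \<Rightarrow> (nat \<Rightarrow> nat) \<Rightarrow> (nat \<Rightarrow> nat \<Rightarrow> real mat) \<Rightarrow> (nat \<Rightarrow> real vec) \<Rightarrow> real mat" where
  "gark_Ahat N s A b = four_block_mat
     (gark_A N s A)                                   (0\<^sub>m (num_stages N s) 1)
     (mat_of_rows (num_stages N s) [gark_b N s b])    (0\<^sub>m 1 1)"

definition gark_Rhat :: "nat \<Rightarrow> (nat \<Rightarrow> nat) \<Rightarrow> (nat \<Rightarrow> real) \<Rightarrow> real mat" where
  "gark_Rhat N s r = diag_block_mat (map (\<lambda>q. r q \<cdot>\<^sub>m 1\<^sub>m (s q)) [0..<N] @ [1\<^sub>m 1])"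

definition am_matrix :: "nat \<Rightarrow> (nat \<Rightarrow> nat) \<Rightarrow> real mat \<Rightarrow> (nat \<Rightarrow> real) \<Rightarrow> real mat" where
  "am_matrix N s Ah r = 1\<^sub>m (num_stages N s + 1) + Ah * gark_Rhat N s r"

(* mat_inverse returns None on singular matrices; abs_monotonic below requires invertibility. *)
definition am_alpha :: "nat \<Rightarrow> (nat \<Rightarrow> nat) \<Rightarrow> real mat \<Rightarrow> (nat \<Rightarrow> real) \<Rightarrow> real vec" where
  "am_alpha N s Ah r =
     the (mat_inverse (am_matrix N s Ah r)) *\<^sub>v Matrix.vec (num_stages N s + 1) (\<lambda>_. 1)"

definition am_beta :: "nat \<Rightarrow> (nat \<Rightarrow> nat) \<Rightarrow> real mat \<Rightarrow> (nat \<Rightarrow> real) \<Rightarrow> real mat" where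
  "am_beta N s Ah r = the (mat_inverse (am_matrix N s Ah r)) * (Ah * gark_Rhat N s r)"

(* The orders on vec and mat are entrywise (and require equal dimensions). *)
definition abs_monotonic :: "nat \<Rightarrow> (nat \<Rightarrow> nat) \<Rightarrow> real mat \<Rightarrow> (nat \<Rightarrow> real) \<Rightarrow> bool" where
  "abs_monotonic N s Ah r \<longleftrightarrow>
     0\<^sub>m (num_stages N s + 1) (num_stages N s + 1) \<le> Ah \<and>
     invertible_mat (am_matrix N s Ah r) \<and>
     0\<^sub>v (num_stages N s + 1) \<le> am_alpha N s Ah r \<and>
     0\<^sub>m (num_stages N s + 1) (num_stages N s + 1) \<le> am_beta N s Ah r"

definition am_region :: "nat \<Rightarrow> (nat \<Rightarrow> nat) \<Rightarrow> real mat \<Rightarrow> (nat \<Rightarrow> real) set" where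
  "am_region N s Ah = {r \<in> topspace (Euclidean_space N).
     (\<forall>q<N. 0 \<le> r q) \<and>
     (\<forall>t \<in> topspace (Euclidean_space N).
        (\<forall>q<N. 0 \<le> t q \<and> t q \<le> r q) \<longrightarrow> abs_monotonic N s Ah t)}"

end

theory Submission
  imports Defs
begin

text \<open>
  Only the value \<open>t q = h / \<rho> q\<close> of the parameters matters. The bound on the step size says
  \<open>0 \<le> t \<le> r\<close>, so the scheme is absolutely monotonic at \<open>t\<close>. Collect the stages and the
  new solution in one vector \<open>u\<close>, write \<open>G = Ahat Rhat(t)\<close>, and let \<open>z\<close> consist of the
  Euler steps \<open>Y q i + \<rho> q *\<^sub>R f q (Y q i)\<close>. Since \<open>h = t q * \<rho> q\<close>, the scheme reads
  \<open>(I + G) u = 1 y + G z\<close>, and multiplication by the inverse of \<open>I + G\<close> gives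
  \<open>u = \<alpha> y + \<beta> z\<close> with \<open>\<alpha>, \<beta> \<ge> 0\<close>. The triangle inequality and the monotonicity of Euler
  steps turn this into the entrywise inequality \<open>(I - \<beta>) \<nu>(u) \<le> \<alpha> \<nu>(y)\<close>. But \<open>I - \<beta>\<close> is
  the inverse of \<open>I + G\<close>, a matrix with nonnegative entries, and \<open>(I + G) \<alpha> = 1\<close>, so
  multiplying by \<open>I + G\<close> yields \<open>\<nu>(u) \<le> \<nu>(y)\<close> in every component.

  The analytic core is \<open>norm_le_of_nonneg_resolvent\<close>; \<open>resolvent_form\<close> is the passage to
  \<open>u = \<alpha> y + \<beta> z\<close>.
\<close>

section \<open>Systems with a nonnegative resolvent\<close>

lemma is_norm_sum_le:
  assumes "is_norm \<nu>" "finite I"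
  shows "\<nu> (\<Sum>i\<in>I. g i) \<le> (\<Sum>i\<in>I. \<nu> (g i))"
  using assms(2)
proof (induction I rule: finite_induct)
  case empty
  have "\<nu> 0 = 0" using assms(1) by (simp only: is_norm_def)
  then show ?case by simp
next
  case (insert x F)
  have "\<nu> (g x + sum g F) \<le> \<nu> (g x) + \<nu> (sum g F)"
    using assms(1) by (simp add: is_norm_def)
  with insert show ?case by simp
qed

text \<open>
  The hypotheses on \<open>\<alpha>\<close> and \<open>\<beta>\<close> say \<open>(I + G) \<alpha> = 1\<close> and \<open>(I + G) \<beta> = G\<close>. Thus the defect
  of the inequality \<open>\<nu>(u) \<le> \<alpha> \<nu>(y) + \<beta> \<nu>(u)\<close>, multiplied by \<open>I + G \<ge> 0\<close>, becomes
  \<open>\<nu>(u) \<le> \<nu>(y)\<close>. Inverting \<open>I - \<beta>\<close> in this way takes the place of any smallness of \<open>\<beta>\<close>.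
\<close>

lemma norm_le_of_nonneg_resolvent:
  fixes \<nu> :: "'v::real_vector \<Rightarrow> real" and \<alpha> :: "nat \<Rightarrow> real" and \<beta> G :: "nat \<Rightarrow> nat \<Rightarrow> real"
  assumes \<nu>: "is_norm \<nu>"
    and \<alpha>0: "\<And>k. k < n \<Longrightarrow> 0 \<le> \<alpha> k"
    and \<beta>0: "\<And>k l. k < n \<Longrightarrow> l < n \<Longrightarrow> 0 \<le> \<beta> k l"
    and G0: "\<And>k l. k < n \<Longrightarrow> l < n \<Longrightarrow> 0 \<le> G k l"
    and \<alpha>: "\<And>k. k < n \<Longrightarrow> \<alpha> k + (\<Sum>l<n. G k l * \<alpha> l) = 1"
    and \<beta>: "\<And>k j. k < n \<Longrightarrow> j < n \<Longrightarrow> \<beta> k j + (\<Sum>l<n. G k l * \<beta> l j) = G k j"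
    and u: "\<And>k. k < n \<Longrightarrow> u k = \<alpha> k *\<^sub>R y + (\<Sum>l<n. \<beta> k l *\<^sub>R z l)"
    and z: "\<And>k. k < n \<Longrightarrow> \<nu> (z k) \<le> \<nu> (u k)"
    and k: "k < n"
  shows "\<nu> (u k) \<le> \<nu> y"
proof -
  define w where "w = (\<lambda>k. \<nu> (u k))"
  have tri: "\<nu> (x + x') \<le> \<nu> x + \<nu> x'" and scale: "0 \<le> c \<Longrightarrow> \<nu> (c *\<^sub>R x) = c * \<nu> x" for x x' c
    using \<nu> by (simp_all add: is_norm_def)
  have w: "w k \<le> \<alpha> k * \<nu> y + (\<Sum>l<n. \<beta> k l * w l)" if k: "k < n" for k
  proof -
    have "w k \<le> \<nu> (\<alpha> k *\<^sub>R y) + (\<Sum>l<n. \<nu> (\<beta> k l *\<^sub>R z l))"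
      unfolding w_def u[OF k]
      by (rule order_trans[OF tri]) (simp add: is_norm_sum_le[OF \<nu>])
    also have "\<dots> \<le> \<alpha> k * \<nu> y + (\<Sum>l<n. \<beta> k l * w l)"
      using k by (auto intro!: add_mono sum_mono mult_left_mono simp: scale \<alpha>0 \<beta>0 z w_def)
    finally show ?thesis .
  qed
  have "w k + (\<Sum>l<n. G k l * w l) \<le> (\<alpha> k * \<nu> y + (\<Sum>l<n. \<beta> k l * w l))
      + (\<Sum>l<n. G k l * (\<alpha> l * \<nu> y + (\<Sum>j<n. \<beta> l j * w j)))"
    using k by (intro add_mono sum_mono mult_left_mono w G0) auto
  also have "(\<Sum>l<n. G k l * (\<alpha> l * \<nu> y + (\<Sum>j<n. \<beta> l j * w j)))
      = (\<Sum>l<n. G k l * \<alpha> l) * \<nu> y + (\<Sum>l<n. \<Sum>j<n. G k l * \<beta> l j * w j)"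
    by (simp add: distrib_left sum.distrib sum_distrib_left sum_distrib_right mult.assoc)
  also have "(\<Sum>l<n. \<Sum>j<n. G k l * \<beta> l j * w j) = (\<Sum>j<n. (\<Sum>l<n. G k l * \<beta> l j) * w j)"
    by (subst sum.swap) (simp add: sum_distrib_right)
  also have "(\<alpha> k * \<nu> y + (\<Sum>l<n. \<beta> k l * w l))
      + ((\<Sum>l<n. G k l * \<alpha> l) * \<nu> y + (\<Sum>j<n. (\<Sum>l<n. G k l * \<beta> l j) * w j))
      = (\<alpha> k + (\<Sum>l<n. G k l * \<alpha> l)) * \<nu> y
        + (\<Sum>j<n. (\<beta> k j + (\<Sum>l<n. G k l * \<beta> l j)) * w j)"
    by (simp add: distrib_right sum.distrib)
  also have "\<dots> = \<nu> y + (\<Sum>j<n. G k j * w j)"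
    using k by (simp add: \<alpha> \<beta>)
  finally show ?thesis by (simp add: w_def)
qed

text \<open>
  Multiplication of \<open>(I + G) u = 1 y + G z\<close> by the left inverse \<open>B\<close> of \<open>I + G\<close>, where the
  unknowns are vectors of an arbitrary real vector space and the coefficients are scalars.
\<close>

lemma resolvent_form:
  fixes B G :: "nat \<Rightarrow> nat \<Rightarrow> real" and u z :: "nat \<Rightarrow> 'v::real_vector"
  assumes B: "\<And>k j. k < n \<Longrightarrow> j < n \<Longrightarrow> B k j + (\<Sum>l<n. B k l * G l j) = (if k = j then 1 else 0)"
    and u: "\<And>k. k < n \<Longrightarrow> u k + (\<Sum>l<n. G k l *\<^sub>R u l) = y + (\<Sum>l<n. G k l *\<^sub>R z l)"
    and k: "k < n"
  shows "u k = (\<Sum>l<n. B k l) *\<^sub>R y + (\<Sum>l<n. (\<Sum>j<n. B k j * G j l) *\<^sub>R z l)"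
proof -
  have swap: "(\<Sum>l<n. (\<Sum>j<n. B k j * G j l) *\<^sub>R x l) = (\<Sum>j<n. B k j *\<^sub>R (\<Sum>l<n. G j l *\<^sub>R x l))"
    for x :: "nat \<Rightarrow> 'v"
    by (simp add: scaleR_sum_left scaleR_sum_right) (rule sum.swap)
  have "u k = (\<Sum>j<n. (if k = j then 1 else 0) *\<^sub>R u j)"
    using k by (simp add: if_distrib[of "\<lambda>c. c *\<^sub>R _"] cong: if_cong)
  also have "\<dots> = (\<Sum>j<n. (B k j + (\<Sum>l<n. B k l * G l j)) *\<^sub>R u j)"
    using k by (simp add: B)
  also have "\<dots> = (\<Sum>j<n. B k j *\<^sub>R (u j + (\<Sum>l<n. G j l *\<^sub>R u l)))"
    by (simp add: scaleR_add_left scaleR_add_right sum.distrib swap)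
  also have "\<dots> = (\<Sum>j<n. B k j *\<^sub>R (y + (\<Sum>l<n. G j l *\<^sub>R z l)))"
    by (simp add: u)
  also have "\<dots> = (\<Sum>l<n. B k l) *\<^sub>R y + (\<Sum>l<n. (\<Sum>j<n. B k j * G j l) *\<^sub>R z l)"
    by (simp add: scaleR_add_right sum.distrib swap sum_distrib_left flip: scaleR_sum_left)
  finally show ?thesis .
qed

section \<open>Absolute monotonicity in coordinates\<close>

lemma mat_inverse_inverts:
  fixes M :: "'a::field mat"
  assumes M: "M \<in> carrier_mat n n" and inv: "invertible_mat M"
  shows "the (mat_inverse M) \<in> carrier_mat n n"
    and "M * the (mat_inverse M) = 1\<^sub>m n"
    and "the (mat_inverse M) * M = 1\<^sub>m n"
proof -
  obtain B where "M * B = 1\<^sub>m n" and "B * M = 1\<^sub>m (dim_row B)"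
    using inv M unfolding invertible_mat_def inverts_mat_def by auto
  moreover from this have "B \<in> carrier_mat n n"
    using M by (metis carrier_matD(2) carrier_matI index_mult_mat(2,3) index_one_mat(2,3))
  ultimately have "M \<in> Units (ring_mat TYPE('a) n ())"
    using M by (auto simp: Units_def ring_mat_def)
  with mat_inverse(1)[OF M, of "()"] obtain C where "mat_inverse M = Some C"
    by (cases "mat_inverse M") auto
  with mat_inverse(2)[OF M this]
  show "the (mat_inverse M) \<in> carrier_mat n n" "M * the (mat_inverse M) = 1\<^sub>m n"
    "the (mat_inverse M) * M = 1\<^sub>m n"
    by auto
qed

lemma index_mult_mat_sum:
  assumes "P \<in> carrier_mat n n" "Q \<in> carrier_mat n n" "k < n" "j < n"
  shows "index_mat (P * Q) (k, j) = (\<Sum>l<n. index_mat P (k, l) * index_mat Q (l, j))"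
  using assms by (simp add: scalar_prod_def atLeast0LessThan)

lemma nonneg_mat_index:
  assumes "0\<^sub>m n n \<le> (P :: real mat)" "k < n" "l < n"
  shows "0 \<le> index_mat P (k, l)"
  using assms by (auto simp: less_eq_mat_def)

text \<open>
  Here \<open>G = Ahat Rhat\<close>. The identity \<open>B (I + G) = I\<close> for \<open>B\<close> the inverse of \<open>I + G\<close> gives
  \<open>u = \<alpha> y + \<beta> z\<close>, while the opposite product \<open>(I + G) B = I\<close> gives \<open>(I + G) \<alpha> = 1\<close> and
  \<open>(I + G) \<beta> = G\<close>.
\<close>

lemma abs_monotonic_norm_le:
  fixes \<nu> :: "'v::real_vector \<Rightarrow> real" and N :: nat and s :: "nat \<Rightarrow> nat"
  defines "n \<equiv> num_stages N s + 1"
  assumes \<nu>: "is_norm \<nu>"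
    and am: "abs_monotonic N s Ah t"
    and R: "gark_Rhat N s t = mat_diag n D"
    and D: "\<And>l. l < n \<Longrightarrow> 0 \<le> D l"
    and u: "\<And>k. k < n \<Longrightarrow> u k + (\<Sum>l<n. (index_mat Ah (k, l) * D l) *\<^sub>R u l)
        = y + (\<Sum>l<n. (index_mat Ah (k, l) * D l) *\<^sub>R z l)"
    and z: "\<And>k. k < n \<Longrightarrow> \<nu> (z k) \<le> \<nu> (u k)"
    and k: "k < n"
  shows "\<nu> (u k) \<le> \<nu> y"
proof -
  note am = am[unfolded abs_monotonic_def am_alpha_def am_beta_def am_matrix_def R,
      folded n_def]
  have Ah: "Ah \<in> carrier_mat n n" using am by (auto simp: less_eq_mat_def)
  define Gm where "Gm = Ah * mat_diag n D"
  define Bm where "Bm = the (mat_inverse (1\<^sub>m n + Gm))"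
  define G where "G = (\<lambda>k l. index_mat Ah (k, l) * D l)"
  define B where "B = (\<lambda>k l. index_mat Bm (k, l))"
  define \<alpha> where "\<alpha> = (\<lambda>k. \<Sum>l<n. B k l)"
  define \<beta> where "\<beta> = (\<lambda>k j. \<Sum>l<n. B k l * G l j)"
  have Gm: "Gm \<in> carrier_mat n n" using Ah unfolding Gm_def by auto
  have GmG: "index_mat Gm (k, l) = G k l" if "k < n" "l < n" for k l
    using that by (simp add: Gm_def mat_diag_mult_right[OF Ah] G_def)
  have M: "1\<^sub>m n + Gm \<in> carrier_mat n n" using Gm by simp
  have inv: "invertible_mat (1\<^sub>m n + Gm)" using am by (simp add: Gm_def)
  note Bm = mat_inverse_inverts[OF M inv, folded Bm_def]
  have left: "B k j + \<beta> k j = (if k = j then 1 else 0)" if kj: "k < n" "j < n" for k j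
  proof -
    have "Bm * (1\<^sub>m n + Gm) = Bm + Bm * Gm"
      using Bm(1) Gm by (simp add: mult_add_distrib_mat[of _ n n _ n])
    then have "index_mat (Bm + Bm * Gm) (k, j) = index_mat (1\<^sub>m n) (k, j)"
      using Bm(3) by simp
    then show ?thesis
      using kj Bm(1) Gm index_mult_mat_sum[OF Bm(1) Gm kj]
      by (simp add: B_def \<beta>_def GmG del: index_mult_mat(1))
  qed
  have right: "B k j + (\<Sum>l<n. G k l * B l j) = (if k = j then 1 else 0)"
    if kj: "k < n" "j < n" for k j
  proof -
    have "(1\<^sub>m n + Gm) * Bm = Bm + Gm * Bm"
      using Bm(1) Gm by (simp add: add_mult_distrib_mat[of _ n n _ _ n])
    then have "index_mat (Bm + Gm * Bm) (k, j) = index_mat (1\<^sub>m n) (k, j)"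
      using Bm(2) by simp
    then show ?thesis
      using kj Bm(1) Gm index_mult_mat_sum[OF Gm Bm(1) kj]
      by (simp add: B_def GmG del: index_mult_mat(1))
  qed
  show ?thesis
  proof (rule norm_le_of_nonneg_resolvent[where n = n and \<alpha> = \<alpha> and \<beta> = \<beta> and G = G and z = z,
        OF \<nu>])
    show "0 \<le> \<alpha> k" if "k < n" for k
    proof -
      have "0\<^sub>v n \<le> Bm *\<^sub>v Matrix.vec n (\<lambda>_. 1)" using am by (simp add: Bm_def Gm_def)
      then have "0 \<le> vec_index (Bm *\<^sub>v Matrix.vec n (\<lambda>_. 1)) k"
        using that by (auto simp: less_eq_vec_def)
      then show ?thesis
        using that Bm(1) by (simp add: \<alpha>_def B_def scalar_prod_def atLeast0LessThan)
    qed
    show "0 \<le> \<beta> k l" if kl: "k < n" "l < n" for k l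
    proof -
      have "0\<^sub>m n n \<le> Bm * Gm" using am by (simp add: Bm_def Gm_def)
      from nonneg_mat_index[OF this kl] show ?thesis
        unfolding index_mult_mat_sum[OF Bm(1) Gm kl] using kl by (simp add: \<beta>_def B_def GmG)
    qed
    show "0 \<le> G k l" if kl: "k < n" "l < n" for k l
      using nonneg_mat_index[of n Ah, OF _ kl] am D[OF kl(2)] by (simp add: G_def)
    show "\<alpha> k + (\<Sum>l<n. G k l * \<alpha> l) = 1" if k: "k < n" for k
    proof -
      have "\<alpha> k + (\<Sum>l<n. G k l * \<alpha> l) = (\<Sum>j<n. B k j + (\<Sum>l<n. G k l * B l j))"
        unfolding \<alpha>_def sum.distrib sum_distrib_left by (subst (2) sum.swap) (rule refl)
      also have "\<dots> = 1" using k by (simp add: right)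
      finally show ?thesis .
    qed
    show "\<beta> k j + (\<Sum>l<n. G k l * \<beta> l j) = G k j" if kj: "k < n" "j < n" for k j
    proof -
      have "\<beta> k j + (\<Sum>l<n. G k l * \<beta> l j)
          = (\<Sum>i<n. (B k i + (\<Sum>l<n. G k l * B l i)) * G i j)"
        unfolding \<beta>_def distrib_right sum.distrib sum_distrib_left sum_distrib_right mult.assoc
        by (subst (2) sum.swap) (rule refl)
      also have "\<dots> = (\<Sum>i<n. (if k = i then 1 else 0) * G i j)"
        using kj by (simp add: right)
      also have "\<dots> = G k j"
        using kj by (simp add: if_distrib[of "\<lambda>c. c * _"] cong: if_cong)
      finally show ?thesis .
    qed
    show "u k = \<alpha> k *\<^sub>R y + (\<Sum>l<n. \<beta> k l *\<^sub>R z l)" if "k < n" for k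
      unfolding \<alpha>_def \<beta>_def
      using left u that by (intro resolvent_form) (simp_all add: \<beta>_def G_def)
  qed (use z k in auto)
qed

section \<open>The stacked system\<close>

text \<open>
  Serves inductions on the number of partitions: the stages of a new partition come last, as
  does its diagonal block.
\<close>

lemma stages_Suc: "stages (Suc N) s = stages N s @ map (Pair N) [0..<s N]"
  by (simp add: stages_def)

lemma length_stages: "length (stages N s) = num_stages N s"
  by (induction N) (simp_all add: stages_def num_stages_def)

lemma set_stages: "set (stages N s) = {(q, i). q < N \<and> i < s q}"
  by (auto simp: stages_def)

lemma sum_stages:
  "(\<Sum>k<num_stages N s. g (stages N s ! k)) = (\<Sum>q<N. \<Sum>i<s q. g (q, i) :: 'b::comm_monoid_add)"
proof -
  have "sum_list (map g (stages N s)) = (\<Sum>q<N. \<Sum>i<s q. g (q, i))"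
    by (induction N)
      (simp_all add: stages_Suc o_def interv_sum_list_conv_sum_set_nat atLeast0LessThan,
        simp add: stages_def)
  then show ?thesis
    by (simp add: sum_list_sum_nth length_stages atLeast0LessThan)
qed

lemma gark_Rhat_eq_mat_diag:
  "gark_Rhat N s t = mat_diag (num_stages N s + 1)
     (\<lambda>l. if l < num_stages N s then t (fst (stages N s ! l)) else 1)"
proof -
  have "diag_block_mat (map (\<lambda>q. t q \<cdot>\<^sub>m 1\<^sub>m (s q)) [0..<N])
      = mat_diag (num_stages N s) (\<lambda>l. t (fst (stages N s ! l)))"
  proof (induction N)
    case 0
    then show ?case by (auto simp: mat_diag_def num_stages_def)
  next
    case (Suc N)
    have "num_stages (Suc N) s = num_stages N s + s N" by (simp add: num_stages_def)
    then show ?case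
      unfolding upt_Suc_append[OF le0] map_append list.map diag_block_mat_last Suc Let_def
      by (intro eq_matI) (auto simp: mat_diag_def stages_Suc nth_append length_stages)
  qed
  then show ?thesis
    unfolding gark_Rhat_def diag_block_mat_last Let_def
    by (intro eq_matI) (auto simp: mat_diag_def)
qed

lemma gark_Ahat_stage_row:
  assumes "k < num_stages N s" "l < num_stages N s"
    and "stages N s ! k = (q, i)"
  shows "index_mat (gark_Ahat N s A b) (k, l)
    = (case stages N s ! l of (m, j) \<Rightarrow> index_mat (A q m) (i, j))"
  using assms by (simp add: gark_Ahat_def gark_A_def)

lemma gark_Ahat_last_row:
  assumes "l < num_stages N s"
  shows "index_mat (gark_Ahat N s A b) (num_stages N s, l)
    = (case stages N s ! l of (q, i) \<Rightarrow> vec_index (b q) i)"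
  using assms by (simp add: gark_Ahat_def gark_A_def gark_b_def mat_of_rows_index)

theorem theorem4p7:
  fixes \<nu> :: "real ^ 'd \<Rightarrow> real"
    and N :: nat
    and f :: "nat \<Rightarrow> real ^ 'd \<Rightarrow> real ^ 'd"
    and \<rho> r :: "nat \<Rightarrow> real"
    and s :: "nat \<Rightarrow> nat"
    and A :: "nat \<Rightarrow> nat \<Rightarrow> real mat"
    and b :: "nat \<Rightarrow> real vec"
    and h :: real
    and y\<^sub>n y\<^sub>n\<^sub>1 :: "real ^ 'd"
    and Y :: "nat \<Rightarrow> nat \<Rightarrow> real ^ 'd"
  assumes "is_norm \<nu>"
    and "N \<ge> 1"
    and "\<forall>m<N. \<rho> m > 0"
    and "\<forall>m<N. \<forall>y. \<nu> (y + \<rho> m *\<^sub>R f m y) \<le> \<nu> y"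
    and "gark_coeffs N s A b"
    and "r \<in> (Euclidean_space N) interior_of (am_region N s (gark_Ahat N s A b))"
    and "\<forall>q<N. r q > 0"
    and "h > 0"
    and "h \<le> (MIN q\<in>{..<N}. r q * \<rho> q)"
    and "gark_step N s A b f h y\<^sub>n Y y\<^sub>n\<^sub>1"
  shows "(\<forall>q<N. \<forall>i<s q. \<nu> (Y q i) \<le> \<nu> y\<^sub>n) \<and> \<nu> y\<^sub>n\<^sub>1 \<le> \<nu> y\<^sub>n"
proof -
  define S where "S = num_stages N s"
  define Ah where "Ah = gark_Ahat N s A b"
  define t where "t = (\<lambda>q. if q < N then h / \<rho> q else 0)"
  define F where "F = (\<lambda>p. f (fst p) (Y (fst p) (snd p)))"
  define u where
    "u = (\<lambda>k. if k < S then case stages N s ! k of (q, i) \<Rightarrow> Y q i else y\<^sub>n\<^sub>1)"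
  \<comment> \<open>The last column of the tableau is zero, so the last entry is free; this choice makes it
    contribute equally to both sides of the system.\<close>
  define z where
    "z = (\<lambda>k. if k < S then u k + \<rho> (fst (stages N s ! k)) *\<^sub>R F (stages N s ! k) else y\<^sub>n\<^sub>1)"
  define D where "D = (\<lambda>l. if l < S then t (fst (stages N s ! l)) else 1)"
  have stage: "fst (stages N s ! k) < N" "snd (stages N s ! k) < s (fst (stages N s ! k))"
    if "k < S" for k
    using nth_mem[of k "stages N s"] that by (auto simp: length_stages S_def set_stages)
  have t: "0 \<le> t q" "t q \<le> r q" "t q * \<rho> q = h" if q: "q < N" for q
  proof -
    have \<rho>: "\<rho> q > 0" using assms(3) q by simp
    have "h \<le> r q * \<rho> q"
      using assms(9) q by (auto intro: order_trans[OF _ Min_le])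
    with \<rho> show "t q \<le> r q" using q by (simp add: t_def pos_divide_le_eq)
    show "0 \<le> t q" "t q * \<rho> q = h" using \<rho> q assms(8) by (simp_all add: t_def)
  qed
  have am: "abs_monotonic N s Ah t"
  proof -
    have "r \<in> am_region N s Ah"
      using assms(6) interior_of_subset[of "Euclidean_space N"] by (auto simp: Ah_def)
    moreover have "t \<in> topspace (Euclidean_space N)"
      by (simp add: topspace_Euclidean_space t_def)
    ultimately show ?thesis
      using t by (auto simp: am_region_def)
  qed
  have step: "u k = y\<^sub>n + h *\<^sub>R (\<Sum>l<S. index_mat Ah (k, l) *\<^sub>R F (stages N s ! l))"
    if "k < S + 1" for k
  proof (cases "k < S")
    case True
    obtain q i where qi: "stages N s ! k = (q, i)" by force
    have "u k = y\<^sub>n + h *\<^sub>R (\<Sum>m<N. \<Sum>j<s m. index_mat (A q m) (i, j) *\<^sub>R F (m, j))"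
      using assms(10) True stage[OF True] by (simp add: gark_step_def u_def qi F_def)
    also have "\<dots> = y\<^sub>n + h *\<^sub>R (\<Sum>l<S. index_mat Ah (k, l) *\<^sub>R F (stages N s ! l))"
      using sum_stages[of "\<lambda>(m, j). index_mat (A q m) (i, j) *\<^sub>R F (m, j)" N s] True
      by (simp add: S_def Ah_def gark_Ahat_stage_row[OF _ _ qi] split_beta)
    finally show ?thesis .
  next
    case False
    then have k: "k = S" using that by simp
    have "u k = y\<^sub>n + h *\<^sub>R (\<Sum>q<N. \<Sum>i<s q. vec_index (b q) i *\<^sub>R F (q, i))"
      using assms(10) by (simp add: gark_step_def u_def k F_def)
    also have "\<dots> = y\<^sub>n + h *\<^sub>R (\<Sum>l<S. index_mat Ah (k, l) *\<^sub>R F (stages N s ! l))"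
      using sum_stages[of "\<lambda>(q, i). vec_index (b q) i *\<^sub>R F (q, i)" N s]
      by (simp add: S_def Ah_def k gark_Ahat_last_row split_beta)
    finally show ?thesis .
  qed
  have system: "u k + (\<Sum>l<S + 1. (index_mat Ah (k, l) * D l) *\<^sub>R u l)
      = y\<^sub>n + (\<Sum>l<S + 1. (index_mat Ah (k, l) * D l) *\<^sub>R z l)" if "k < S + 1" for k
  proof -
    have "(index_mat Ah (k, l) * D l) *\<^sub>R z l
        = (index_mat Ah (k, l) * D l) *\<^sub>R u l + h *\<^sub>R index_mat Ah (k, l) *\<^sub>R F (stages N s ! l)"
      if "l < S" for l
      using t(3)[OF stage(1)[OF that]] that
      by (simp add: z_def D_def scaleR_add_right mult.assoc mult.commute)
    moreover have "z S = u S" by (simp add: z_def u_def)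
    ultimately show ?thesis
      using step[OF that] by (simp add: sum.distrib scaleR_sum_right)
  qed
  have z: "\<nu> (z k) \<le> \<nu> (u k)" for k
    using assms(4) stage(1)[of k] by (auto simp: z_def u_def F_def split_beta)
  have bound: "\<nu> (u k) \<le> \<nu> y\<^sub>n" if "k < S + 1" for k
  proof (rule abs_monotonic_norm_le[OF assms(1) am, where D = D and u = u and z = z])
    show "gark_Rhat N s t = mat_diag (num_stages N s + 1) D"
      by (simp add: gark_Rhat_eq_mat_diag D_def S_def)
    show "0 \<le> D l" for l
      using t(1)[OF stage(1)] by (simp add: D_def)
  qed (use system z that in \<open>simp_all add: S_def\<close>)
  show ?thesis
  proof (intro conjI allI impI)
    fix q i assume "q < N" "i < s q"
    then have "(q, i) \<in> set (stages N s)" by (simp add: set_stages)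
    then obtain k where "k < S" "stages N s ! k = (q, i)"
      unfolding in_set_conv_nth length_stages S_def by blast
    then show "\<nu> (Y q i) \<le> \<nu> y\<^sub>n" using bound[of k] by (simp add: u_def)
  next
    show "\<nu> y\<^sub>n\<^sub>1 \<le> \<nu> y\<^sub>n" using bound[of S] by (simp add: u_def)
  qed
qed

end
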